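(* Let $(L;V)$ be any nonnegative pair, with $L\in\mathbb{R}^{n\times n}$, $V\in\mathbb{R}^{n\times p}$, $0\le p\le n$, and let $\mathcal{X}$ be an extended L-ensemble based on $(L;V)$. Let $Q\in\mathbb{R}^{n\times p}$ have columns forming an orthonormal basis of the column span of $V$, and let $\widetilde L=(I-QQ^\top)L(I-QQ^\top)$. Then $\mathcal{X}$ is a determinantal point process with marginal kernel $$K = QQ^\top + \widetilde L\,(I+\widetilde L)^{-1}.$$
   Context: All matrices are real. The ground set is $\Omega$, identified with $\{1,\dots,n\}$; a point process is a random subset $\mathcal{X}\subseteq\Omega$. For a matrix $A$ and index sets $X,Y$, $A_{X,Y}$ is the submatrix with rows in $X$ and columns in $Y$, $A_X=A_{X,X}$, and $A_{X,:}$ keeps the rows in $X$ and all columns. The determinant of an empty matrix is $1$. Determinantal point process (DPP): for a symmetric $K\in\mathbb{R}^{n\times n}$ with $0\preceq K\preceq I$, $\mathcal{X}$ is a DPP with marginal kernel $K$ if $\mathbf{P}(A\subseteq\mathcal{X})=\det K_A$ for all $A\subseteq\Omega$. Nonnegative pair (NNP): a pair $(L;V)$ with $L\in\mathbb{R}^{n\times n}$ symmetric, $V\in\mathbb{R}^{n\times p}$, $0\le p\le n$, $V$ of full column rank, and $L$ conditionally positive semi-definite with respect to $V$, i.e. $x^\top Lx\ge 0$ for all $x\in\mathbb{R}^n$ with $V^\top x=0$. (The case $p=0$ is allowed: then $L$ is positive semi-definite, and $\widetilde L=L$.) Extended L-ensemble based on the NNP $(L;V)$: a point process $\mathcal{X}$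 such that, for all $X\subseteq\Omega$, $$\mathbf{P}(\mathcal{X}=X)\propto(-1)^p\det\begin{pmatrix}L_X&V_{X,:}\\(V_{X,:})^\top&0\end{pmatrix}.$$ *)

theory Defs
  imports
    "HOL-Probability.Probability"
    "Jordan_Normal_Form.DL_Rank"
    "Jordan_Normal_Form.DL_Submatrix"
    "Jordan_Normal_Form.Gauss_Jordan_Elimination"
begin

text \<open>
  The ground set is \<open>{..<n}\<close>, matching the 0-based indices of \<open>'a mat\<close>. Matrices with
  zero columns are admitted, so \<open>p = 0\<close> needs no separate treatment.
\<close>

definition symmetric_mat :: "real mat \<Rightarrow> bool" where
  "symmetric_mat A \<longleftrightarrow> transpose_mat A = A"

text \<open>Symmetry is not part of this notion; it is required separately where needed.\<close>

definition pos_semidef :: "nat \<Rightarrow> real mat \<Rightarrow> bool" where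
  "pos_semidef n A \<longleftrightarrow> (\<forall>x \<in> carrier_vec n. 0 \<le> scalar_prod x (A *\<^sub>v x))"

definition point_process :: "nat \<Rightarrow> 'w measure \<Rightarrow> ('w \<Rightarrow> nat set) \<Rightarrow> bool" where
  "point_process n M \<X> \<longleftrightarrow>
     prob_space M \<and> \<X> \<in> measurable M (count_space (Pow {..<n}))"

definition DPP :: "nat \<Rightarrow> 'w measure \<Rightarrow> ('w \<Rightarrow> nat set) \<Rightarrow> real mat \<Rightarrow> bool" where
  "DPP n M \<X> K \<longleftrightarrow>
     point_process n M \<X> \<and>
     K \<in> carrier_mat n n \<and> symmetric_mat K \<and>
     pos_semidef n K \<and> pos_semidef n (1\<^sub>m n - K) \<and>
     (\<forall>A \<subseteq> {..<n}.
        measure M {\<omega> \<in> space M. A \<subseteq> \<X> \<omega>} = Determinant.det (submatrix K A A))"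

definition nonneg_pair :: "nat \<Rightarrow> nat \<Rightarrow> real mat \<Rightarrow> real mat \<Rightarrow> bool" where
  "nonneg_pair n p L V \<longleftrightarrow>
     p \<le> n \<and>
     L \<in> carrier_mat n n \<and> symmetric_mat L \<and>
     V \<in> carrier_mat n p \<and> vec_space.rank n V = p \<and>
     (\<forall>x \<in> carrier_vec n.
        transpose_mat V *\<^sub>v x = 0\<^sub>v p \<longrightarrow> 0 \<le> scalar_prod x (L *\<^sub>v x))"

definition ext_L_weight :: "nat \<Rightarrow> real mat \<Rightarrow> real mat \<Rightarrow> nat set \<Rightarrow> real" where
  "ext_L_weight p L V X =
     (- 1) ^ p *
     Determinant.det
       (four_block_mat
          (submatrix L X X)                      (submatrix V X {..<p})
          (transpose_mat (submatrix V X {..<p})) (0\<^sub>m p p))"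

text \<open>
  The constant \<open>c\<close> is the inverse of the normalising constant; it is positive because
  the weights are nonnegative and the probabilities sum to 1.
\<close>

definition ext_L_ensemble ::
  "nat \<Rightarrow> nat \<Rightarrow> 'w measure \<Rightarrow> ('w \<Rightarrow> nat set) \<Rightarrow> real mat \<Rightarrow> real mat \<Rightarrow> bool" where
  "ext_L_ensemble n p M \<X> L V \<longleftrightarrow>
     nonneg_pair n p L V \<and>
     point_process n M \<X> \<and>
     (\<exists>c. \<forall>X \<subseteq> {..<n}.
        measure M {\<omega> \<in> space M. \<X> \<omega> = X} = c * ext_L_weight p L V X)"

definition orthonormal_basis_of_col_span :: "nat \<Rightarrow> nat \<Rightarrow> real mat \<Rightarrow> real mat \<Rightarrow> bool" where
  "orthonormal_basis_of_col_span n p V Q \<longleftrightarrow>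
     Q \<in> carrier_mat n p \<and>
     (\<forall>i < p. \<forall>j < p. scalar_prod (col Q i) (col Q j) = (if i = j then 1 else 0)) \<and>
     vec_space.col_space n Q = vec_space.col_space n V"

definition L_tilde :: "nat \<Rightarrow> real mat \<Rightarrow> real mat \<Rightarrow> real mat" where
  "L_tilde n L Q =
     (1\<^sub>m n - Q * transpose_mat Q) * L * (1\<^sub>m n - Q * transpose_mat Q)"

end

theory Submission
  imports Defs
begin

text \<open>
  Write \<open>P = Q Q\<^sup>T\<close>, \<open>N = I + L~\<close> where \<open>L~\<close> is the compressed matrix \<open>L_tilde n L Q\<close>, and call
  \<open>[[M, U], [U\<^sup>T, 0]]\<close> the bordering of \<open>M\<close> by \<open>U\<close>. The weight of \<open>X\<close> is, up to the sign
  \<open>(-1)^p\<close>, a principal minor of the bordering of \<open>L\<close> by \<open>V\<close> whose index set contains all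
  border indices. Expanding a determinant with a diagonal summand into principal minors
  (\<open>det_add_diag\<close>) therefore sums the weights of all \<open>X \<supseteq> A\<close> at once: the sum is, up to sign,
  the determinant of the bordering of \<open>L + I - E\<close> by \<open>V\<close>, with \<open>E\<close> the diagonal indicator
  matrix of \<open>A\<close> (\<open>sum_ext_L_weight_superset\<close>).

  Three facts evaluate this determinant. The border sees \<open>V = Q R\<close> only through \<open>Q\<close>, at the
  price of the factor \<open>(det R)\<^sup>2\<close> (\<open>det_bordered_mult\<close>). Adding multiples of the border to the
  corner changes nothing, so \<open>L\<close> may be replaced by \<open>L~\<close> (\<open>det_bordered_add\<close>). Finally the
  inverse of the bordering of \<open>N\<close> by \<open>Q\<close> has the upper left block \<open>S = N^{-1} - P\<close>, because
  \<open>N Q = Q\<close>; hence subtracting \<open>E\<close> from \<open>N\<close> multiplies the determinant by \<open>det (I - S E)\<close>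
  (\<open>det_bordered_minus\<close>), which is the minor of \<open>K = I - S = P + L~ N^{-1}\<close> on \<open>A\<close>
  (\<open>det_one_minus_restricted_cols\<close>). So the inclusion probabilities are a constant times the
  principal minors of \<open>K\<close>, and \<open>A = {}\<close> shows that the constant is 1.

  The columns of \<open>I - P\<close> lie in the kernel of \<open>V\<^sup>T\<close>, where \<open>L\<close> is nonnegative, so \<open>L~\<close> is
  positive semi-definite (\<open>L_tilde_pos_semidef\<close>) and \<open>N\<close> is invertible.
  That \<open>0 \<le> K \<le> I\<close> holds in the semi-definite order follows from expressing \<open>L~ N^{-1}\<close> and
  \<open>S\<close> as congruences of matrices that are visibly positive semi-definite
  (\<open>resolvent_kernel\<close>).
\<close>

section \<open>Principal minors as permutation sums\<close>

text \<open>
  The Leibniz sum over the permutations of \<open>S\<close> itself. Unlike \<open>submatrix\<close>, it needs no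
  enumeration of \<open>S\<close>, so index sets can be split and enlarged freely.
\<close>
definition principal_minor :: "'a::comm_ring_1 mat \<Rightarrow> nat set \<Rightarrow> 'a" where
  "principal_minor B S =
     (\<Sum>\<pi> | \<pi> permutes S. of_int (sign \<pi>) * (\<Prod>i\<in>S. B $$ (i, \<pi> i)))"

text \<open>
  Conjugation with \<open>f\<close> carries the permutations of \<open>{0..<k}\<close> to those of \<open>S\<close> and preserves
  signs.
\<close>
lemma det_reindexed_eq_principal_minor:
  assumes f: "bij_betw f {0..<k} S"
  shows "Determinant.det (mat k k (\<lambda>(i, j). B $$ (f i, f j))) = principal_minor B S"
proof -
  have inj: "inj_on f {0..<k}" and im: "f ` {0..<k} = S"
    using f by (auto simp: bij_betw_def)
  have bij: "bij_betw (map_permutation {0..<k} f) {\<pi>. \<pi> permutes {0..<k}} {\<pi>. \<pi> permutes S}"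
  proof -
    have "map_permutation {0..<k} f
        = (\<lambda>\<pi> x. if x \<in> S then f (\<pi> (inv_into {0..<k} f x)) else x)"
      by (auto simp: fun_eq_iff map_permutation_def restrict_id_def im)
    then show ?thesis using bij_betw_permutations[OF f] by simp
  qed
  have "principal_minor B S
      = (\<Sum>\<pi> | \<pi> permutes {0..<k}. of_int (sign (map_permutation {0..<k} f \<pi>))
           * (\<Prod>i\<in>S. B $$ (i, map_permutation {0..<k} f \<pi> i)))"
    unfolding principal_minor_def by (rule sum.reindex_bij_betw[OF bij, symmetric])
  also have "\<dots> = (\<Sum>\<pi> | \<pi> permutes {0..<k}. of_int (sign \<pi>)
           * (\<Prod>i\<in>{0..<k}. B $$ (f i, f (\<pi> i))))"
  proof (rule sum.cong[OF refl])
    fix \<pi> assume "\<pi> \<in> {\<pi>. \<pi> permutes {0..<k}}"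
    then have \<pi>: "\<pi> permutes {0..<k}" by simp
    have "(\<Prod>i\<in>S. B $$ (i, map_permutation {0..<k} f \<pi> i))
        = (\<Prod>i\<in>{0..<k}. B $$ (f i, map_permutation {0..<k} f \<pi> (f i)))"
      by (rule prod.reindex_bij_betw[OF f, symmetric])
    also have "\<dots> = (\<Prod>i\<in>{0..<k}. B $$ (f i, f (\<pi> i)))"
      by (rule prod.cong) (simp_all add: map_permutation_apply[OF inj])
    finally show "of_int (sign (map_permutation {0..<k} f \<pi>))
           * (\<Prod>i\<in>S. B $$ (i, map_permutation {0..<k} f \<pi> i))
         = of_int (sign \<pi>) * (\<Prod>i\<in>{0..<k}. B $$ (f i, f (\<pi> i)))"
      by (simp add: sign_map_permutation[OF inj \<pi>])
  qed
  also have "\<dots> = Determinant.det (mat k k (\<lambda>(i, j). B $$ (f i, f j)))"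
  proof -
    have "\<pi> i < k" if "\<pi> permutes {0..<k}" "i < k" for \<pi> i
      using permutes_in_image[OF that(1), of i] that(2) by simp
    then show ?thesis
      by (simp add: Determinant.det_def)
  qed
  finally show ?thesis by simp
qed

lemma bij_betw_pick:
  assumes "finite S"
  shows "bij_betw (pick S) {0..<card S} S"
proof -
  have inj: "inj_on (pick S) {0..<card S}"
    using pick_mono_le[of _ S] by (auto simp: inj_on_def) (metis nat_neq_iff)
  have "pick S ` {0..<card S} \<subseteq> S"
    using pick_in_set_le[of _ S] by auto
  then have "pick S ` {0..<card S} = S"
    using card_image[OF inj] assms by (simp add: card_subset_eq)
  with inj show ?thesis by (simp add: bij_betw_def)
qed

lemma det_submatrix_eq_principal_minor:
  assumes B: "B \<in> carrier_mat m m" and S: "S \<subseteq> {..<m}"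
  shows "Determinant.det (submatrix B S S) = principal_minor B S"
proof -
  have "{i. i < m \<and> i \<in> S} = S" "finite S"
    using S by (auto intro: finite_subset)
  then show ?thesis
    using B det_reindexed_eq_principal_minor[OF bij_betw_pick, of S B]
    by (simp add: submatrix_def)
qed

text \<open>
  Multiply out the Leibniz product. A diagonal factor chosen at \<open>i\<close> survives only if the
  permutation fixes \<open>i\<close>; so when \<open>S\<close> is the set of the other positions, exactly the
  permutations of \<open>S\<close> remain.
\<close>
lemma det_add_diag:
  assumes B: "B \<in> carrier_mat m m"
  shows "Determinant.det (B + mat_diag m d)
       = (\<Sum>S\<in>Pow {0..<m}. (\<Prod>i\<in>{0..<m} - S. d i) * principal_minor B S)"
proof -
  let ?I = "{0..<m}"
  have lt: "\<pi> i < m" if "\<pi> permutes ?I" "i < m" for \<pi> i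
    using permutes_in_image[OF that(1), of i] that(2) by simp
  have diag: "(\<Prod>i\<in>?I - S. if i = \<pi> i then d i else 0)
      = (if \<pi> permutes S then \<Prod>i\<in>?I - S. d i else 0)"
    if \<pi>: "\<pi> permutes ?I" and S: "S \<subseteq> ?I" for \<pi> S
  proof (cases "\<forall>i\<in>?I - S. \<pi> i = i")
    case True
    then have "\<pi> permutes S" using permutes_superset[OF \<pi>] by auto
    with True show ?thesis by (auto intro: prod.cong)
  next
    case False
    then obtain i where i: "i \<in> ?I - S" "\<pi> i \<noteq> i" by auto
    then have "\<not> \<pi> permutes S" by (auto dest: permutes_not_in)
    moreover have "(\<Prod>i\<in>?I - S. if i = \<pi> i then d i else 0) = 0"
      using i by (intro prod_zero bexI[of _ i]) auto
    ultimately show ?thesis by simp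
  qed
  have "Determinant.det (B + mat_diag m d)
      = (\<Sum>\<pi> | \<pi> permutes ?I. of_int (sign \<pi>) * (\<Prod>i\<in>?I. (B + mat_diag m d) $$ (i, \<pi> i)))"
    using B by (simp add: Determinant.det_def mat_diag_def)
  also have "\<dots> = (\<Sum>\<pi> | \<pi> permutes ?I. of_int (sign \<pi>)
                 * (\<Prod>i\<in>?I. B $$ (i, \<pi> i) + (if i = \<pi> i then d i else 0)))"
    using B lt by (intro sum.cong refl arg_cong2[of _ _ _ _ "(*)"] prod.cong) (auto simp: mat_diag_def)
  also have "\<dots> = (\<Sum>\<pi> | \<pi> permutes ?I. \<Sum>S\<in>Pow ?I. of_int (sign \<pi>)
                 * ((\<Prod>i\<in>S. B $$ (i, \<pi> i)) * (\<Prod>i\<in>?I - S. if i = \<pi> i then d i else 0)))"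
    by (simp add: prod_add sum_distrib_left)
  also have "\<dots> = (\<Sum>S\<in>Pow ?I. \<Sum>\<pi> | \<pi> permutes ?I. of_int (sign \<pi>)
                 * ((\<Prod>i\<in>S. B $$ (i, \<pi> i)) * (\<Prod>i\<in>?I - S. if i = \<pi> i then d i else 0)))"
    by (rule sum.swap)
  also have "\<dots> = (\<Sum>S\<in>Pow ?I. (\<Prod>i\<in>?I - S. d i) * principal_minor B S)"
  proof (rule sum.cong[OF refl])
    fix S assume "S \<in> Pow ?I"
    then have S: "S \<subseteq> ?I" by simp
    have "(\<Sum>\<pi> | \<pi> permutes ?I. of_int (sign \<pi>)
            * ((\<Prod>i\<in>S. B $$ (i, \<pi> i)) * (\<Prod>i\<in>?I - S. if i = \<pi> i then d i else 0)))
        = (\<Sum>\<pi> | \<pi> permutes S. of_int (sign \<pi>)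
            * ((\<Prod>i\<in>S. B $$ (i, \<pi> i)) * (\<Prod>i\<in>?I - S. d i)))"
      using S by (intro sum.mono_neutral_cong_right)
        (auto simp: finite_permutations diag permutes_subset[OF _ S] intro: permutes_subset)
    then show "(\<Sum>\<pi> | \<pi> permutes ?I. of_int (sign \<pi>)
            * ((\<Prod>i\<in>S. B $$ (i, \<pi> i)) * (\<Prod>i\<in>?I - S. if i = \<pi> i then d i else 0)))
        = (\<Prod>i\<in>?I - S. d i) * principal_minor B S"
      by (simp add: principal_minor_def sum_distrib_left mult_ac)
  qed
  finally show ?thesis .
qed

text \<open>
  Let \<open>E\<close> be the diagonal indicator matrix of \<open>A\<close>. Since \<open>I - S E = (I - S) E + (I - E)\<close>,
  the diagonal expansion applies: the minor of \<open>(I - S) E\<close> on an index set not containing \<open>A\<close>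
  gets coefficient 0, and the minor on a strictly larger set than \<open>A\<close> has a zero column.
\<close>
lemma det_one_minus_restricted_cols:
  fixes S :: "'a::comm_ring_1 mat"
  assumes S: "S \<in> carrier_mat n n" and A: "A \<subseteq> {..<n}"
  shows "Determinant.det (1\<^sub>m n - S * mat_diag n (\<lambda>i. if i \<in> A then 1 else 0))
       = Determinant.det (submatrix (1\<^sub>m n - S) A A)"
proof -
  let ?I = "{0..<n}" and ?c = "\<lambda>i. if i \<in> A then 0 else (1::'a)"
  let ?K = "1\<^sub>m n - S" and ?B = "(1\<^sub>m n - S) * mat_diag n (\<lambda>i. if i \<in> A then 1 else 0)"
  have K: "?K \<in> carrier_mat n n" and B: "?B \<in> carrier_mat n n"
    using S mult_carrier_mat[OF minus_carrier_mat[OF S] mat_diag_dim] by auto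
  have B_ij: "?B $$ (i, j) = (if j \<in> A then ?K $$ (i, j) else 0)" if "i < n" "j < n" for i j
    using that mat_diag_mult_right[OF K] by simp
  have only_A: "(\<Prod>i\<in>?I - X. ?c i) * principal_minor ?B X = 0" if "X \<subseteq> ?I" "X \<noteq> A" for X
  proof (cases "A \<subseteq> X")
    case False
    then obtain i where "i \<in> A" "i \<notin> X" by blast
    then have "(\<Prod>i\<in>?I - X. ?c i) = 0"
      using A by (intro prod_zero bexI[of _ i]) auto
    then show ?thesis by simp
  next
    case True
    with that obtain j where j: "j \<in> X" "j \<notin> A" by auto
    have "(\<Prod>i\<in>X. ?B $$ (i, \<pi> i)) = 0" if \<pi>: "\<pi> permutes X" for \<pi>
    proof -
      obtain i where i: "i \<in> X" "\<pi> i = j"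
        using j(1) permutes_image[OF \<pi>] by (metis imageE)
      then have "?B $$ (i, \<pi> i) = 0"
        using j \<open>X \<subseteq> ?I\<close> by (subst B_ij) auto
      with i(1) \<open>X \<subseteq> ?I\<close> show ?thesis
        by (intro prod_zero) (auto intro: finite_subset)
    qed
    then show ?thesis by (simp add: principal_minor_def)
  qed
  have "1\<^sub>m n - S * mat_diag n (\<lambda>i. if i \<in> A then 1 else 0) = ?B + mat_diag n ?c"
    by (rule eq_matI) (use S mat_diag_mult_right[OF S] mat_diag_mult_right[OF K] in
        \<open>auto simp: mat_diag_def\<close>)
  then have "Determinant.det (1\<^sub>m n - S * mat_diag n (\<lambda>i. if i \<in> A then 1 else 0))
      = (\<Sum>X\<in>Pow ?I. (\<Prod>i\<in>?I - X. ?c i) * principal_minor ?B X)"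
    using det_add_diag[OF B] by simp
  also have "\<dots> = (\<Sum>X\<in>{A}. (\<Prod>i\<in>?I - X. ?c i) * principal_minor ?B X)"
    by (rule sum.mono_neutral_right) (use A only_A in auto)
  also have "\<dots> = principal_minor ?B A"
    by simp
  also have "\<dots> = principal_minor ?K A"
  proof -
    have "?B $$ (i, \<pi> i) = ?K $$ (i, \<pi> i)" if "\<pi> permutes A" "i \<in> A" for \<pi> i
      using B_ij[of i "\<pi> i"] permutes_in_image[OF that(1), of i] that(2) A by auto
    then show ?thesis by (simp add: principal_minor_def)
  qed
  finally show ?thesis
    using det_submatrix_eq_principal_minor[OF K A] by simp
qed

section \<open>Bordered matrices\<close>

lemma pick_lessThan:
  assumes "j < p"
  shows "pick {..<p} j = j"
proof -
  have "{a \<in> {..<p}. a < j} = {..<j}"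
    using assms by auto
  then show ?thesis
    using pick_card_in_set[of j "{..<p}"] assms by simp
qed

definition bordered_mat :: "'a::comm_ring_1 mat \<Rightarrow> 'a mat \<Rightarrow> 'a mat" where
  "bordered_mat M U =
     four_block_mat M U (transpose_mat U) (0\<^sub>m (dim_col U) (dim_col U))"

lemma bordered_mat_carrier:
  assumes "M \<in> carrier_mat n n" "U \<in> carrier_mat n p"
  shows "bordered_mat M U \<in> carrier_mat (n + p) (n + p)"
  using assms by (simp add: bordered_mat_def)

text \<open>
  The bordering of the submatrices is the principal submatrix of the large bordering obtained
  by enumerating \<open>X\<close> and then the border indices \<open>n, \<dots>, n + p - 1\<close>.
\<close>
lemma det_bordered_submatrix:
  assumes M: "M \<in> carrier_mat n n" and U: "U \<in> carrier_mat n p" and X: "X \<subseteq> {..<n}"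
  shows "Determinant.det (bordered_mat (submatrix M X X) (submatrix U X {..<p}))
       = principal_minor (bordered_mat M U) (X \<union> {n..<n+p})"
proof -
  define k where "k = card X"
  define f where "f i = (if i < k then pick X i else i - k + n)" for i
  have finX: "finite X" and Xn: "{i. i < n \<and> i \<in> X} = X" and pp: "{j. j < p \<and> j \<in> {..<p}} = {..<p}"
    using X by (auto intro: finite_subset)
  have pick_lt: "pick X i < n" if "i < k" for i
    using pick_in_set_le[of i X] that X by (auto simp: k_def)
  have "bij_betw f {0..<k} X"
    using bij_betw_pick[OF finX] by (subst bij_betw_cong[of _ f "pick X"]) (auto simp: f_def k_def)
  moreover have "bij_betw f {k..<k+p} {n..<n+p}"
    by (rule bij_betwI[where g = "\<lambda>j. j - n + k"]) (auto simp: f_def)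
  moreover have "X \<inter> {n..<n+p} = {}"
    using X by auto
  ultimately have "bij_betw f ({0..<k} \<union> {k..<k+p}) (X \<union> {n..<n+p})"
    by (rule bij_betw_combine)
  moreover have "{0..<k} \<union> {k..<k+p} = {0..<k+p}"
    by auto
  ultimately have f: "bij_betw f {0..<k+p} (X \<union> {n..<n+p})"
    by simp
  let ?M' = "submatrix M X X" and ?U' = "submatrix U X {..<p}"
  have M': "?M' \<in> carrier_mat k k" "\<And>i j. i < k \<Longrightarrow> j < k \<Longrightarrow> ?M' $$ (i, j) = M $$ (pick X i, pick X j)"
    using M Xn by (auto simp: submatrix_def k_def)
  have U': "?U' \<in> carrier_mat k p" "\<And>i j. i < k \<Longrightarrow> j < p \<Longrightarrow> ?U' $$ (i, j) = U $$ (pick X i, j)"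
    using U Xn pp by (auto simp: submatrix_def k_def pick_lessThan)
  have "bordered_mat ?M' ?U' = mat (k+p) (k+p) (\<lambda>(i, j). bordered_mat M U $$ (f i, f j))"
  proof (rule eq_matI)
    fix i j
    assume "i < dim_row (mat (k+p) (k+p) (\<lambda>(i, j). bordered_mat M U $$ (f i, f j)))"
      "j < dim_col (mat (k+p) (k+p) (\<lambda>(i, j). bordered_mat M U $$ (f i, f j)))"
    then have ij: "i < k + p" "j < k + p" by simp_all
    have "f i < n + p" "f j < n + p"
      using ij pick_lt[of i] pick_lt[of j] by (auto simp: f_def)
    then have "bordered_mat M U $$ (f i, f j) = (if f i < n
        then if f j < n then M $$ (f i, f j) else U $$ (f i, f j - n)
        else if f j < n then U $$ (f j, f i - n) else 0)"
      using M U by (simp add: bordered_mat_def)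
    moreover have "bordered_mat ?M' ?U' $$ (i, j) = (if i < k
        then if j < k then ?M' $$ (i, j) else ?U' $$ (i, j - k)
        else if j < k then ?U' $$ (j, i - k) else 0)"
      using M'(1) U'(1) ij by (simp add: bordered_mat_def)
    moreover have "f i < n \<longleftrightarrow> i < k" "f j < n \<longleftrightarrow> j < k"
      using pick_lt[of i] pick_lt[of j] by (auto simp: f_def)
    ultimately show "bordered_mat ?M' ?U' $$ (i, j)
        = mat (k+p) (k+p) (\<lambda>(i, j). bordered_mat M U $$ (f i, f j)) $$ (i, j)"
      using ij M'(2) U'(2) by (simp add: f_def)
  qed (use M'(1) U'(1) in \<open>auto simp: bordered_mat_def\<close>)
  then show ?thesis
    using det_reindexed_eq_principal_minor[OF f] by simp
qed

text \<open>
  The diagonal vanishes on the border, so that the diagonal expansion of the right-hand side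
  keeps only index sets containing the whole border.
\<close>
lemma bordered_mat_add_diag:
  assumes M: "M \<in> carrier_mat n n" and U: "U \<in> carrier_mat n p"
  shows "bordered_mat (M + mat_diag n d) U
       = bordered_mat M U + mat_diag (n + p) (\<lambda>i. if i < n then d i else 0)"
  by (rule eq_matI) (use M U in \<open>auto simp: bordered_mat_def mat_diag_def\<close>)

text \<open>
  The new bordering is \<open>diag(I, R\<^sup>T) * [[M, U], [U\<^sup>T, 0]] * diag(I, R)\<close>.
\<close>
lemma det_bordered_mult:
  fixes M U R :: "'a::idom mat"
  assumes M: "M \<in> carrier_mat n n" and U: "U \<in> carrier_mat n p" and R: "R \<in> carrier_mat p p"
  shows "Determinant.det (bordered_mat M (U * R))
       = (Determinant.det R)\<^sup>2 * Determinant.det (bordered_mat M U)"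
proof -
  let ?F = "\<lambda>R. four_block_mat (1\<^sub>m n) (0\<^sub>m n p) (0\<^sub>m p n) R"
  have F: "?F R' \<in> carrier_mat (n + p) (n + p)" "Determinant.det (?F R') = Determinant.det R'"
    if "R' \<in> carrier_mat p p" for R' :: "'a mat"
    using that det_four_block_mat_upper_right_zero[of "1\<^sub>m n" n "0\<^sub>m n p" p "0\<^sub>m p n" R'] by auto
  have "bordered_mat M (U * R) = ?F (transpose_mat R) * bordered_mat M U * ?F R"
    using M U R
    by (simp add: bordered_mat_def transpose_mult[OF U R]
        mult_four_block_mat[of _ n n _ p _ p _ _ n _ p])
  then show ?thesis
    using F[OF R] F[of "transpose_mat R"] R bordered_mat_carrier[OF M U]
    by (simp add: det_mult[of _ "n + p"] mult_carrier_mat[of _ "n + p" "n + p"] det_transpose power2_eq_square)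
qed

text \<open>
  Block row and column operations with the border blocks: both multipliers are unipotent.
\<close>
lemma det_bordered_add:
  fixes M U B C :: "'a::idom mat"
  assumes M: "M \<in> carrier_mat n n" and U: "U \<in> carrier_mat n p"
    and B: "B \<in> carrier_mat n p" and C: "C \<in> carrier_mat p n"
  shows "Determinant.det (bordered_mat (M + U * C + B * transpose_mat U) U)
       = Determinant.det (bordered_mat M U)"
proof -
  let ?Lo = "four_block_mat (1\<^sub>m n) (0\<^sub>m n p) C (1\<^sub>m p)"
  let ?Up = "four_block_mat (1\<^sub>m n) B (0\<^sub>m p n) (1\<^sub>m p)"
  have "bordered_mat (M + U * C + B * transpose_mat U) U = ?Up * (bordered_mat M U * ?Lo)"
    using M U B C
    by (simp add: bordered_mat_def
        mult_four_block_mat[of _ n n _ p _ p _ _ n _ p])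
  moreover have "?Up \<in> carrier_mat (n + p) (n + p)" "?Lo \<in> carrier_mat (n + p) (n + p)"
    using B C by auto
  moreover have "Determinant.det ?Up = 1" "Determinant.det ?Lo = 1"
    using B C det_four_block_mat_upper_right_zero[of "1\<^sub>m n" n "0\<^sub>m n p" p C "1\<^sub>m p"]
      det_four_block_mat_lower_left_zero[of "1\<^sub>m n" n B p "0\<^sub>m p n" "1\<^sub>m p"] by auto
  ultimately show ?thesis
    using bordered_mat_carrier[OF M U] by (simp add: det_mult[of _ "n + p"] mult_carrier_mat[of _ "n + p" "n + p"])
qed

text \<open>
  The two equations say that the bordering \<open>[[N, U], [U\<^sup>T, 0]]\<close> maps the block column
  \<open>[S, U\<^sup>T]\<close> to \<open>[I, 0]\<close>. Subtracting \<open>E\<close> in the corner is thus right multiplication by the block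
  lower triangular matrix \<open>[[I - S E, 0], [-U\<^sup>T E, I]]\<close>.
\<close>
lemma det_bordered_minus:
  fixes N U S E :: "'a::idom mat"
  assumes N: "N \<in> carrier_mat n n" and U: "U \<in> carrier_mat n p"
    and S: "S \<in> carrier_mat n n" and E: "E \<in> carrier_mat n n"
    and NS: "N * S + U * transpose_mat U = 1\<^sub>m n" and US: "transpose_mat U * S = 0\<^sub>m p n"
  shows "Determinant.det (bordered_mat (N - E) U)
       = Determinant.det (bordered_mat N U) * Determinant.det (1\<^sub>m n - S * E)"
proof -
  let ?T = "four_block_mat (1\<^sub>m n - S * E) (0\<^sub>m n p) (- (transpose_mat U * E)) (1\<^sub>m p)"
  have SE: "1\<^sub>m n - S * E \<in> carrier_mat n n" and UE: "- (transpose_mat U * E) \<in> carrier_mat p n"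
    using U S E by (auto intro: minus_carrier_mat mult_carrier_mat)
  then have T: "?T \<in> carrier_mat (n + p) (n + p)"
    by auto
  have "N * S * E + U * transpose_mat U * E = E"
    using arg_cong[OF NS, of "\<lambda>Z. Z * E"] N U S E
    by (simp add: add_mult_distrib_mat[of _ n n _ _ n])
  then have E_eq: "N * (S * E) + U * (transpose_mat U * E) = E"
    using N U S E by (simp add: assoc_mult_mat[of _ n n _ n _ n] assoc_mult_mat[of _ n p _ n _ n])
  have "N * (1\<^sub>m n - S * E) + U * - (transpose_mat U * E)
      = N - (N * (S * E) + U * (transpose_mat U * E))"
    using N U S E
    by (subst mult_minus_distrib_mat[of _ n n _ n])
      (auto intro!: eq_matI simp: algebra_simps)
  then have top: "N * (1\<^sub>m n - S * E) + U * - (transpose_mat U * E) = N - E"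
    using E_eq by simp
  have bot: "transpose_mat U * (1\<^sub>m n - S * E) = transpose_mat U"
  proof -
    have "transpose_mat U * (S * E) = 0\<^sub>m p n"
      using U S E US by (simp flip: assoc_mult_mat[of _ p n _ n _ n])
    then show ?thesis
      using U S E by (subst mult_minus_distrib_mat[of _ p n _ n]) (auto intro!: eq_matI)
  qed
  have Ut: "transpose_mat U \<in> carrier_mat p n"
    using U by simp
  then have zero: "transpose_mat U + - 0\<^sub>m p n = transpose_mat U"
    by (auto intro!: eq_matI)
  have "bordered_mat (N - E) U = bordered_mat N U * ?T"
    using N U E SE UE top bot zero minus_carrier_mat[OF E, of N]
    by (simp add: bordered_mat_def mult_four_block_mat[OF N U Ut zero_carrier_mat SE zero_carrier_mat UE one_carrier_mat])
  moreover have "Determinant.det ?T = Determinant.det (1\<^sub>m n - S * E)"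
    using det_four_block_mat_upper_right_zero[OF SE refl UE one_carrier_mat] by simp
  ultimately show ?thesis
    using bordered_mat_carrier[OF N U] T by (simp add: det_mult[of _ "n + p"] mult_carrier_mat[of _ "n + p" "n + p"])
qed

section \<open>Inclusion probabilities of an extended L-ensemble\<close>

lemma prob_superset_eq_sum:
  assumes pp: "point_process n M \<X>" and A: "A \<subseteq> {..<n}"
  shows "measure M {\<omega> \<in> space M. A \<subseteq> \<X> \<omega>}
       = (\<Sum>X | A \<subseteq> X \<and> X \<subseteq> {..<n}. measure M {\<omega> \<in> space M. \<X> \<omega> = X})"
proof -
  interpret prob_space M
    using pp by (simp add: point_process_def)
  have meas: "\<X> \<in> measurable M (count_space (Pow {..<n}))"
    using pp by (simp add: point_process_def)
  let ?S = "{X. A \<subseteq> X \<and> X \<subseteq> {..<n}}"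
  have fin: "finite ?S"
    by (rule finite_subset[of _ "Pow {..<n}"]) auto
  have ev: "{\<omega> \<in> space M. \<X> \<omega> = X} \<in> sets M" if "X \<subseteq> {..<n}" for X
    using measurable_sets[OF meas, of "{X}"] that by (simp add: vimage_def Int_def conj_commute)
  have "{\<omega> \<in> space M. A \<subseteq> \<X> \<omega>} = (\<Union>X\<in>?S. {\<omega> \<in> space M. \<X> \<omega> = X})"
    using measurable_space[OF meas] by auto
  then show ?thesis
    using ev by (simp, subst finite_measure_finite_Union[OF fin])
      (auto simp: disjoint_family_on_def)
qed

text \<open>
  With the diagonal equal to 1 exactly on the indices in \<open>{..<n} - A\<close>, the coefficient of the
  principal minor on \<open>S\<close> is 1 if \<open>S\<close> contains \<open>A\<close> and the border, and 0 otherwise. The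
  remaining index sets are the unions of a set \<open>X \<supseteq> A\<close> with the border.
\<close>
lemma sum_ext_L_weight_superset:
  assumes L: "L \<in> carrier_mat n n" and V: "V \<in> carrier_mat n p" and A: "A \<subseteq> {..<n}"
  shows "(\<Sum>X | A \<subseteq> X \<and> X \<subseteq> {..<n}. ext_L_weight p L V X)
       = (- 1) ^ p * Determinant.det (bordered_mat (L + mat_diag n (\<lambda>i. if i \<in> A then 0 else 1)) V)"
proof -
  let ?P = "{n..<n+p}" and ?I = "{0..<n+p}"
  let ?d = "\<lambda>i. if i < n then if i \<in> A then 0 else 1 else (0::real)"
  have weight: "ext_L_weight p L V X = (- 1) ^ p * principal_minor (bordered_mat L V) (X \<union> ?P)"
    if "X \<subseteq> {..<n}" for X
  proof -
    have "dim_col (submatrix V X {..<p}) = p"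
      using V by (simp add: dim_submatrix)
    then show ?thesis
      using det_bordered_submatrix[OF L V that] by (simp add: ext_L_weight_def bordered_mat_def)
  qed
  have coeff: "(\<Prod>i\<in>?I - S. ?d i) = (if A \<union> ?P \<subseteq> S then 1 else 0)" if "S \<subseteq> ?I" for S
  proof (cases "A \<union> ?P \<subseteq> S")
    case True
    then have "?d i = 1" if "i \<in> ?I - S" for i
      using that by (cases "i < n") (auto simp: subset_iff)
    with True show ?thesis by simp
  next
    case False
    then obtain i where "i \<in> A \<union> ?P" "i \<notin> S" by blast
    then show ?thesis
      using False A by (auto intro!: prod_zero bexI[of _ i])
  qed
  have "Determinant.det (bordered_mat (L + mat_diag n (\<lambda>i. if i \<in> A then 0 else 1)) V)
      = (\<Sum>S\<in>Pow ?I. (\<Prod>i\<in>?I - S. ?d i) * principal_minor (bordered_mat L V) S)"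
    unfolding bordered_mat_add_diag[OF L V]
    by (rule det_add_diag[OF bordered_mat_carrier[OF L V]])
  also have "\<dots> = (\<Sum>S | A \<union> ?P \<subseteq> S \<and> S \<subseteq> ?I. principal_minor (bordered_mat L V) S)"
    by (rule sum.mono_neutral_cong_right) (auto simp: coeff)
  also have "\<dots> = (\<Sum>X | A \<subseteq> X \<and> X \<subseteq> {..<n}. principal_minor (bordered_mat L V) (X \<union> ?P))"
    by (rule sum.reindex_bij_witness[of _ "\<lambda>X. X \<union> ?P" "\<lambda>S. S \<inter> {..<n}"])
      (use A in \<open>auto simp: Un_absorb2 subset_iff intro!: arg_cong[where f = "principal_minor _"]\<close>)
  finally show ?thesis
    by (simp add: weight sum_distrib_left)
qed

section \<open>Positive semi-definiteness and the resolvent\<close>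

lemma scalar_prod_self_eq_sum_squares:
  fixes x :: "real vec"
  shows "x \<bullet> x = (\<Sum>i<dim_vec x. (x $ i)\<^sup>2)"
  by (simp add: scalar_prod_def power2_eq_square lessThan_atLeast0)

lemma pos_semidef_one: "pos_semidef n (1\<^sub>m n)"
  by (simp add: pos_semidef_def scalar_prod_self_eq_sum_squares sum_nonneg)

lemma pos_semidef_add:
  assumes "A \<in> carrier_mat n n" "B \<in> carrier_mat n n" "pos_semidef n A" "pos_semidef n B"
  shows "pos_semidef n (A + B)"
  using assms
  by (auto simp: pos_semidef_def add_mult_distrib_mat_vec[of _ n n] scalar_prod_add_distrib[of _ n])

lemma quadratic_form_congruence:
  assumes M: "M \<in> carrier_mat m m" and C: "C \<in> carrier_mat m n" and x: "x \<in> carrier_vec n"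
  shows "x \<bullet> ((transpose_mat C * M * C) *\<^sub>v x) = (C *\<^sub>v x) \<bullet> (M *\<^sub>v (C *\<^sub>v (x :: real vec)))"
proof -
  let ?y = "C *\<^sub>v x"
  have y: "?y \<in> carrier_vec m"
    using C x by simp
  then have My: "M *\<^sub>v ?y \<in> carrier_vec m"
    using M by simp
  have "x \<bullet> ((transpose_mat C * M * C) *\<^sub>v x) = x \<bullet> (transpose_mat C *\<^sub>v (M *\<^sub>v ?y))"
    using M C x by (simp add: assoc_mult_mat_vec[of _ n m _ n] assoc_mult_mat_vec[of _ n m _ m])
  also have "\<dots> = (transpose_mat C *\<^sub>v (M *\<^sub>v ?y)) \<bullet> x"
    using My C x by (intro comm_scalar_prod[of _ n]) auto
  also have "\<dots> = (M *\<^sub>v ?y) \<bullet> ?y"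
    by (rule transpose_vec_mult_scalar[OF C x My])
  also have "\<dots> = ?y \<bullet> (M *\<^sub>v ?y)"
    by (rule comm_scalar_prod[OF My y])
  finally show ?thesis .
qed

lemma pos_semidef_congruence:
  assumes "M \<in> carrier_mat m m" "C \<in> carrier_mat m n" "pos_semidef m M"
  shows "pos_semidef n (transpose_mat C * M * C)"
  using assms quadratic_form_congruence[of M m C n] by (simp add: pos_semidef_def)

text \<open>
  A kernel vector \<open>v\<close> would satisfy \<open>v \<bullet> v = - v \<bullet> A v \<le> 0\<close>.
\<close>
lemma det_one_plus_pos_semidef:
  assumes A: "A \<in> carrier_mat n n" and psd: "pos_semidef n A"
  shows "Determinant.det (1\<^sub>m n + A) \<noteq> 0"
proof
  assume "Determinant.det (1\<^sub>m n + A) = 0"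
  then obtain v where v: "v \<in> carrier_vec n" "v \<noteq> 0\<^sub>v n" "(1\<^sub>m n + A) *\<^sub>v v = 0\<^sub>v n"
    using det_0_iff_vec_prod_zero_field[of "1\<^sub>m n + A" n] A by auto
  have "v \<bullet> v + v \<bullet> (A *\<^sub>v v) = v \<bullet> ((1\<^sub>m n + A) *\<^sub>v v)"
    using A v(1) by (simp add: add_mult_distrib_mat_vec[of _ n n] scalar_prod_add_distrib[of _ n])
  also have "\<dots> = 0"
    using v by simp
  finally have "v \<bullet> v \<le> 0"
    using psd v(1) by (auto simp: pos_semidef_def dest: bspec[of _ _ v])
  then have "(\<Sum>i<n. (v $ i)\<^sup>2) = 0"
    using v(1) by (intro antisym sum_nonneg) (auto simp: scalar_prod_self_eq_sum_squares)
  then have "v = 0\<^sub>v n"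
    using v(1) by (auto simp: sum_nonneg_eq_0_iff)
  with v(2) show False ..
qed

text \<open>
  Here \<open>B = (I + A)^{-1}\<close> and \<open>P\<close> is an orthogonal projection killed by \<open>A\<close>. The two
  semi-definite bounds are congruences by the symmetric matrix \<open>B\<close>:
  \<open>A B = B (A + A\<^sup>T A) B\<close> and \<open>B - P = B (A + J) B\<close>, where the complementary projection
  \<open>J = I - P = J\<^sup>T J\<close> enters through \<open>A + J = (I + A) - P\<close> and \<open>B P B = P\<close>.
\<close>
lemma resolvent_kernel:
  assumes A: "A \<in> carrier_mat n n" and As: "transpose_mat A = A" and psd: "pos_semidef n A"
    and P: "P \<in> carrier_mat n n" and Ps: "transpose_mat P = P" and PP: "P * P = P" and AP: "A * P = 0\<^sub>m n n"
    and B: "B \<in> carrier_mat n n" and NB: "(1\<^sub>m n + A) * B = 1\<^sub>m n" and BN: "B * (1\<^sub>m n + A) = 1\<^sub>m n"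
  shows "1\<^sub>m n - (B - P) = P + A * B"
    and "symmetric_mat (P + A * B)"
    and "pos_semidef n (P + A * B)"
    and "pos_semidef n (B - P)"
proof -
  let ?N = "1\<^sub>m n + A"
  have N: "?N \<in> carrier_mat n n"
    using A by simp
  have NP: "?N * P = P"
    using A P AP by (simp add: add_mult_distrib_mat[of _ n n _ _ n])
  have "transpose_mat ?N = ?N"
    using A As by (simp add: transpose_add[of _ n n])
  then have "transpose_mat B * ?N = 1\<^sub>m n"
    using NB transpose_mult[OF N B] by simp
  have Bs: "transpose_mat B = B"
  proof -
    have "transpose_mat B = transpose_mat B * (?N * B)"
      using NB B by simp
    also have "\<dots> = (transpose_mat B * ?N) * B"
      using B N by (simp add: assoc_mult_mat[of _ n n _ n _ n])
    also have "\<dots> = B"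
      using \<open>transpose_mat B * ?N = 1\<^sub>m n\<close> B by simp
    finally show ?thesis .
  qed
  have BP: "B * P = P"
  proof -
    have "B * P = B * (?N * P)"
      using NP by simp
    also have "\<dots> = (B * ?N) * P"
      using B N P by (simp add: assoc_mult_mat[of _ n n _ n _ n])
    finally show ?thesis
      using BN P by simp
  qed
  have "B + A * B = 1\<^sub>m n"
    using NB A B by (simp add: add_mult_distrib_mat[of _ n n _ _ n])
  then show K_eq: "1\<^sub>m n - (B - P) = P + A * B"
    using A B P by (auto simp: mat_eq_iff algebra_simps)
  have "transpose_mat (B - P) = B - P"
    using B P Bs Ps by (simp add: transpose_minus[of _ n n])
  then have "transpose_mat (1\<^sub>m n - (B - P)) = 1\<^sub>m n - (B - P)"
    using transpose_minus[OF one_carrier_mat minus_carrier_mat[OF P]] by simp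
  then show "symmetric_mat (P + A * B)"
    by (simp add: symmetric_mat_def K_eq)
  have Gram: "pos_semidef n (C * C)" if "C \<in> carrier_mat n n" "transpose_mat C = C" for C
    using pos_semidef_congruence[OF _ that(1) pos_semidef_one] that by simp
  show "pos_semidef n (P + A * B)"
  proof -
    have "A * B = B * (A + A * A) * B"
    proof -
      have "A + A * A = ?N * A"
        using A by (simp add: add_mult_distrib_mat[of _ n n _ _ n])
      then have "B * (A + A * A) = (B * ?N) * A"
        using A B by (simp add: assoc_mult_mat[of _ n n _ n _ n])
      then show ?thesis
        using BN A by simp
    qed
    moreover have "pos_semidef n (transpose_mat B * (A + A * A) * B)"
      using A B psd Gram[OF A As] by (intro pos_semidef_congruence[of _ n] pos_semidef_add) auto
    ultimately have "pos_semidef n (A * B)"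
      using Bs by simp
    moreover have "pos_semidef n P"
      using Gram[OF P Ps] PP by simp
    ultimately show ?thesis
      using A B P by (intro pos_semidef_add) auto
  qed
  show "pos_semidef n (B - P)"
  proof -
    let ?J = "1\<^sub>m n - P"
    have J: "?J \<in> carrier_mat n n" and Js: "transpose_mat ?J = ?J"
      using P Ps by (auto simp: transpose_minus[of _ n n])
    have "?J * ?J = ?J - P * ?J"
      using P J by (subst minus_mult_distrib_mat[of _ n n _ _ n]) auto
    also have "P * ?J = P - P * P"
      using P by (subst mult_minus_distrib_mat[of _ n n _ n]) auto
    finally have JJ: "?J * ?J = ?J"
      using P PP by auto
    have "B - P = B * (A + ?J) * B"
    proof -
      have "A + ?J = ?N - P"
        using A P by auto
      then have "B * (A + ?J) = B * ?N - B * P"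
        using N B P by (simp add: mult_minus_distrib_mat[of _ n n _ n])
      then have "B * (A + ?J) * B = B - P * B"
        using BN BP B P by (simp add: minus_mult_distrib_mat[of _ n n _ _ n])
      moreover have "P * B = P"
        using arg_cong[OF BP, of transpose_mat] transpose_mult[OF B P] Bs Ps by simp
      ultimately show ?thesis by simp
    qed
    moreover have "pos_semidef n (transpose_mat B * (A + ?J) * B)"
      using A B J psd Gram[OF J Js] JJ by (intro pos_semidef_congruence[of _ n] pos_semidef_add) auto
    ultimately show ?thesis
      using Bs by simp
  qed
qed

section \<open>Compression to the orthogonal complement of the column span\<close>

lemma orthonormal_basis_gram:
  assumes "orthonormal_basis_of_col_span n p V Q"
  shows "transpose_mat Q * Q = 1\<^sub>m p"
  using assms by (intro eq_matI) (auto simp: orthonormal_basis_of_col_span_def)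

text \<open>
  Each column of \<open>V\<close> has the form \<open>Q x\<close>, and \<open>Q\<^sup>T Q = I\<close> gives \<open>Q Q\<^sup>T (Q x) = Q x\<close>.
\<close>
lemma orthonormal_basis_factor:
  assumes ob: "orthonormal_basis_of_col_span n p V Q" and V: "V \<in> carrier_mat n p"
  shows "V = Q * (transpose_mat Q * V)"
proof (rule eq_matI)
  interpret vec_space "TYPE(real)" n .
  have Q: "Q \<in> carrier_mat n p" and sp: "col_space Q = col_space V"
    using ob by (auto simp: orthonormal_basis_of_col_span_def)
  note QQ = orthonormal_basis_gram[OF ob]
  have col_eq: "col (Q * (transpose_mat Q * V)) j = col V j" if j: "j < p" for j
  proof -
    have "col V j \<in> set (cols V)"
      using V j by (metis carrier_matD(2) cols_length cols_nth nth_mem)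
    then have "col V j \<in> col_space V"
      unfolding col_space_def using V cols_dim[of V] by (intro span_mem) auto
    then obtain x where x: "x \<in> carrier_vec p" "Q *\<^sub>v x = col V j"
      using col_space_eq[OF Q] Q sp by auto
    have "col (Q * (transpose_mat Q * V)) j = Q *\<^sub>v col (transpose_mat Q * V) j"
      using Q V j by (intro col_mult2[of _ n p _ p]) auto
    also have "col (transpose_mat Q * V) j = transpose_mat Q *\<^sub>v col V j"
      using Q V j by (intro col_mult2[of _ p n _ p]) auto
    also have "transpose_mat Q *\<^sub>v col V j = (transpose_mat Q * Q) *\<^sub>v x"
      using Q x by (simp add: assoc_mult_mat_vec[of _ p n _ p])
    also have "\<dots> = x"
      using QQ x by simp
    finally show ?thesis
      using x by simp
  qed
  show "V $$ (i, j) = (Q * (transpose_mat Q * V)) $$ (i, j)"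
    if "i < dim_row (Q * (transpose_mat Q * V))" "j < dim_col (Q * (transpose_mat Q * V))" for i j
    using arg_cong[OF col_eq, of j "\<lambda>v. v $ i"] that Q V by auto
qed (use assms in \<open>auto simp: orthonormal_basis_of_col_span_def\<close>)

locale orthonormal_columns =
  fixes n p :: nat and Q :: "real mat"
  assumes Q: "Q \<in> carrier_mat n p" and QQ: "transpose_mat Q * Q = 1\<^sub>m p"
begin

lemma projection_carrier: "Q * transpose_mat Q \<in> carrier_mat n n"
  using Q by simp

lemma projection_symmetric: "transpose_mat (Q * transpose_mat Q) = Q * transpose_mat Q"
  using Q by (simp add: transpose_mult[of _ n p _ n])

lemma projection_mult_basis: "(Q * transpose_mat Q) * Q = Q"
  using Q QQ by (simp add: assoc_mult_mat[of _ n p _ n _ p])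

lemma projection_idempotent: "(Q * transpose_mat Q) * (Q * transpose_mat Q) = Q * transpose_mat Q"
  using Q projection_mult_basis projection_carrier
  by (simp flip: assoc_mult_mat[of _ n n _ p _ n])

lemma complement_symmetric:
  "transpose_mat (1\<^sub>m n - Q * transpose_mat Q) = 1\<^sub>m n - Q * transpose_mat Q"
  using transpose_minus[OF one_carrier_mat projection_carrier] projection_symmetric by simp

lemma complement_carrier: "1\<^sub>m n - Q * transpose_mat Q \<in> carrier_mat n n"
  by (rule minus_carrier_mat[OF projection_carrier])

lemma complement_mult_basis: "(1\<^sub>m n - Q * transpose_mat Q) * Q = 0\<^sub>m n p"
  using Q projection_carrier projection_mult_basis
  by (simp add: minus_mult_distrib_mat[of _ n n _ _ p])

end

text \<open>
  The matrix and its compression differ by terms with a factor \<open>Q\<close> on the left or \<open>Q\<^sup>T\<close> on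
  the right, which are the terms that a border by \<open>Q\<close> absorbs.
\<close>
lemma L_tilde_decomposition:
  assumes L: "L \<in> carrier_mat n n" and Q: "Q \<in> carrier_mat n p"
  defines "P \<equiv> Q * transpose_mat Q"
  shows "L_tilde n L Q + P * L + (L - P * L) * P = L"
proof -
  have P: "P \<in> carrier_mat n n"
    using Q by (simp add: P_def)
  define W where "W = L - P * L"
  have W: "W \<in> carrier_mat n n"
    using P L by (auto simp: W_def)
  have "(1\<^sub>m n - P) * L = W"
    using P L by (simp add: W_def minus_mult_distrib_mat[of _ n n _ _ n])
  then have Lt: "L_tilde n L Q = W - W * P"
    using W P by (simp add: L_tilde_def P_def[symmetric] mult_minus_distrib_mat[of _ n n _ n])
  have "L_tilde n L Q + P * L + W * P = W + P * L"
    unfolding Lt by (rule eq_matI) (use W P L in auto)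
  also have "\<dots> = L"
    unfolding W_def by (rule eq_matI) (use L P in auto)
  finally show ?thesis
    by (simp add: W_def)
qed

locale projected_form = orthonormal_columns +
  fixes L :: "real mat"
  assumes L: "L \<in> carrier_mat n n" and Ls: "symmetric_mat L"
begin

lemma L_tilde_carrier: "L_tilde n L Q \<in> carrier_mat n n"
  using complement_carrier L by (simp add: L_tilde_def)

lemma L_tilde_symmetric: "transpose_mat (L_tilde n L Q) = L_tilde n L Q"
proof -
  let ?J = "1\<^sub>m n - Q * transpose_mat Q"
  note J = complement_carrier
  have JL: "?J * L \<in> carrier_mat n n"
    using J L by simp
  have "transpose_mat (?J * L * ?J) = ?J * (L * ?J)"
    using transpose_mult[OF JL J] transpose_mult[OF J L] complement_symmetric Ls
    by (simp add: symmetric_mat_def)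
  then show ?thesis
    using assoc_mult_mat[OF J L J] by (simp add: L_tilde_def)
qed

lemma L_tilde_mult_basis: "L_tilde n L Q * Q = 0\<^sub>m n p"
proof -
  let ?J = "1\<^sub>m n - Q * transpose_mat Q"
  note J = complement_carrier
  have JL: "?J * L \<in> carrier_mat n n"
    using J L by simp
  show ?thesis
    unfolding L_tilde_def assoc_mult_mat[OF JL J Q] complement_mult_basis
    by (rule right_mult_zero_mat[OF JL])
qed

lemma L_tilde_mult_projection: "L_tilde n L Q * (Q * transpose_mat Q) = 0\<^sub>m n n"
proof -
  have Qt: "transpose_mat Q \<in> carrier_mat p n"
    using Q by simp
  show ?thesis
    unfolding assoc_mult_mat[OF L_tilde_carrier Q Qt, symmetric] L_tilde_mult_basis
    by (rule left_mult_zero_mat[OF Qt])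
qed

text \<open>
  The complementary projection maps every vector into the kernel of \<open>(Q R)\<^sup>T\<close>, where \<open>L\<close> is
  nonnegative by assumption.
\<close>
lemma L_tilde_pos_semidef:
  assumes R: "R \<in> carrier_mat p p"
    and cpd: "\<forall>x \<in> carrier_vec n. transpose_mat (Q * R) *\<^sub>v x = 0\<^sub>v p \<longrightarrow> 0 \<le> x \<bullet> (L *\<^sub>v x)"
  shows "pos_semidef n (L_tilde n L Q)"
  unfolding pos_semidef_def
proof
  let ?J = "1\<^sub>m n - Q * transpose_mat Q"
  note J = complement_carrier
  fix x :: "real vec" assume x: "x \<in> carrier_vec n"
  have "transpose_mat Q * ?J = transpose_mat (?J * Q)"
    using transpose_mult[OF J Q] complement_symmetric by simp
  then have "transpose_mat Q * ?J = 0\<^sub>m p n"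
    by (simp add: complement_mult_basis)
  moreover have "0\<^sub>m p n *\<^sub>v x = 0\<^sub>v p"
    using x by (auto intro!: eq_vecI)
  ultimately have "transpose_mat Q *\<^sub>v (?J *\<^sub>v x) = 0\<^sub>v p"
    using assoc_mult_mat_vec[OF transpose_carrier_mat[THEN iffD2, OF Q] J x] x by auto
  then have "transpose_mat R *\<^sub>v (transpose_mat Q *\<^sub>v (?J *\<^sub>v x)) = 0\<^sub>v p"
    using R by auto
  then have "transpose_mat (Q * R) *\<^sub>v (?J *\<^sub>v x) = 0\<^sub>v p"
    using Q R J x by (simp add: transpose_mult[OF Q R] assoc_mult_mat_vec[of _ p p _ n])
  then have "0 \<le> (?J *\<^sub>v x) \<bullet> (L *\<^sub>v (?J *\<^sub>v x))"
    using cpd J x by simp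
  then show "0 \<le> x \<bullet> (L_tilde n L Q *\<^sub>v x)"
    using quadratic_form_congruence[OF L J x] complement_symmetric by (simp add: L_tilde_def)
qed

text \<open>
  Combines the determinant identities for borderings. The factor in front of the principal
  minor does not depend on \<open>A\<close>, which is what normalisation uses.
\<close>
lemma det_bordered_eq_marginal:
  assumes R: "R \<in> carrier_mat p p" and A: "A \<subseteq> {..<n}"
    and B: "B \<in> carrier_mat n n" and NB: "(1\<^sub>m n + L_tilde n L Q) * B = 1\<^sub>m n"
  shows "Determinant.det (bordered_mat (L + mat_diag n (\<lambda>i. if i \<in> A then 0 else 1)) (Q * R))
       = (Determinant.det R)\<^sup>2 * Determinant.det (bordered_mat (1\<^sub>m n + L_tilde n L Q) Q)
         * Determinant.det (submatrix (1\<^sub>m n - (B - Q * transpose_mat Q)) A A)"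
proof -
  let ?P = "Q * transpose_mat Q" and ?Lt = "L_tilde n L Q"
  let ?N = "1\<^sub>m n + ?Lt" and ?S = "B - Q * transpose_mat Q"
  let ?D = "mat_diag n (\<lambda>i. if i \<in> A then 0 else 1)"
    and ?E = "mat_diag n (\<lambda>i. if i \<in> A then 1 else (0::real))"
  let ?W = "L - ?P * L"
  note P = projection_carrier and Lt = L_tilde_carrier
  have Qt: "transpose_mat Q \<in> carrier_mat p n" and N: "?N \<in> carrier_mat n n"
    and S: "?S \<in> carrier_mat n n" and W: "?W \<in> carrier_mat n n"
    using Q B P Lt L by auto
  \<comment> \<open>The diagonal indicator matrix \<open>?D\<close> of the complement of \<open>A\<close> is \<open>I - ?E\<close>.\<close>
  have "?N - ?E + Q * (transpose_mat Q * L) + (?W * Q) * transpose_mat Q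
      = (?N - ?E) + ?P * L + ?W * ?P"
    using assoc_mult_mat[OF Q Qt L] assoc_mult_mat[OF W Q Qt] by simp
  also have "\<dots> = (?Lt + ?P * L + ?W * ?P) + ?D"
    using Lt L Q by (auto simp: mat_eq_iff mat_diag_def)
  also have "\<dots> = L + ?D"
    using L_tilde_decomposition[OF L Q] by simp
  finally have "Determinant.det (bordered_mat (L + ?D) Q) = Determinant.det (bordered_mat (?N - ?E) Q)"
    using det_bordered_add[OF minus_carrier_mat[OF mat_diag_dim, of ?N] Q mult_carrier_mat[OF W Q]
        mult_carrier_mat[OF Qt L]] by metis
  also have "\<dots> = Determinant.det (bordered_mat ?N Q) * Determinant.det (1\<^sub>m n - ?S * ?E)"
  proof (rule det_bordered_minus[OF N Q S mat_diag_dim])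
    have "?N * ?P = ?P"
      using P Lt L_tilde_mult_projection left_mult_one_mat[OF P]
      by (simp add: add_mult_distrib_mat[of _ n n _ _ n])
    then have "?N * ?S = 1\<^sub>m n - ?P"
      using mult_minus_distrib_mat[OF N B P] NB by simp
    then show "?N * ?S + ?P = 1\<^sub>m n"
      using P by (auto simp: mat_eq_iff)
    have "transpose_mat Q * ?Lt = 0\<^sub>m p n"
      using transpose_mult[OF Lt Q] L_tilde_mult_basis L_tilde_symmetric by simp
    then have "transpose_mat Q * ?N = transpose_mat Q"
      using Qt Lt by (simp add: mult_add_distrib_mat[of _ p n _ n])
    then have QB: "transpose_mat Q * B = transpose_mat Q"
      using assoc_mult_mat[OF Qt N B] NB Qt by simp
    have "transpose_mat Q * ?P = transpose_mat Q"
      using assoc_mult_mat[OF Qt Q Qt] QQ Qt by simp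
    then show "transpose_mat Q * ?S = 0\<^sub>m p n"
      using mult_minus_distrib_mat[OF Qt B P] QB Qt by simp
  qed
  also have "Determinant.det (1\<^sub>m n - ?S * ?E) = Determinant.det (submatrix (1\<^sub>m n - ?S) A A)"
    by (rule det_one_minus_restricted_cols[OF S A])
  finally show ?thesis
    using det_bordered_mult[OF add_carrier_mat[OF mat_diag_dim] Q R] by simp
qed

end

section \<open>The marginal kernel\<close>

theorem theorem2p9:
  fixes n p :: nat
    and L V Q :: "real mat"
    and M :: "'w measure"
    and \<X> :: "'w \<Rightarrow> nat set"
  assumes "nonneg_pair n p L V"
    and "ext_L_ensemble n p M \<X> L V"
    and "orthonormal_basis_of_col_span n p V Q"
  shows "invertible_mat (1\<^sub>m n + L_tilde n L Q) \<and>
         DPP n M \<X>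
           (Q * transpose_mat Q
            + L_tilde n L Q * the (mat_inverse (1\<^sub>m n + L_tilde n L Q)))"
proof -
  let ?P = "Q * transpose_mat Q" and ?Lt = "L_tilde n L Q"
  let ?N = "1\<^sub>m n + L_tilde n L Q"
  define R where "R = transpose_mat Q * V"
  have L: "L \<in> carrier_mat n n" and Ls: "symmetric_mat L" and V: "V \<in> carrier_mat n p"
    using assms(1) by (auto simp: nonneg_pair_def)
  have Q: "Q \<in> carrier_mat n p"
    using assms(3) by (simp add: orthonormal_basis_of_col_span_def)
  have QQ: "transpose_mat Q * Q = 1\<^sub>m p"
    by (rule orthonormal_basis_gram[OF assms(3)])
  have R: "R \<in> carrier_mat p p"
    using Q V by (simp add: R_def)
  have VR: "V = Q * R"
    unfolding R_def by (rule orthonormal_basis_factor[OF assms(3) V])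
  interpret projected_form n p Q L
    by unfold_locales (fact Q QQ L Ls)+
  note P = projection_carrier and Lt = L_tilde_carrier
  have N: "?N \<in> carrier_mat n n"
    using Lt by simp
  have psd: "pos_semidef n ?Lt"
    using assms(1) by (intro L_tilde_pos_semidef[OF R]) (simp add: nonneg_pair_def VR[symmetric])
  obtain B where B: "B \<in> carrier_mat n n" "?N * B = 1\<^sub>m n" "B * ?N = 1\<^sub>m n"
    and inv: "the (mat_inverse ?N) = B"
  proof (cases "mat_inverse ?N")
    case None
    then show ?thesis
      using mat_inverse(1)[OF N, of "()"]
        det_non_zero_imp_unit[OF N det_one_plus_pos_semidef[OF Lt psd], of "()"] by simp
  next
    case (Some B)
    then show ?thesis
      using mat_inverse(2)[OF N Some] that[of B] by simp
  qed
  have "invertible_mat ?N"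
    using Lt N B by (auto simp: invertible_mat_def inverts_mat_def square_mat.simps intro!: exI[of _ B])
  let ?K = "?P + ?Lt * B"
  note kernel = resolvent_kernel[OF Lt L_tilde_symmetric psd P
      projection_symmetric projection_idempotent
      L_tilde_mult_projection B]
  obtain c where c: "\<And>X. X \<subseteq> {..<n} \<Longrightarrow>
      measure M {\<omega> \<in> space M. \<X> \<omega> = X} = c * ext_L_weight p L V X"
    and pp: "point_process n M \<X>"
    using assms(2) by (auto simp: ext_L_ensemble_def)
  interpret prob_space M
    using pp by (simp add: point_process_def)
  define Z where "Z = c * (- 1) ^ p * (Determinant.det R)\<^sup>2 * Determinant.det (bordered_mat ?N Q)"
  have incl: "measure M {\<omega> \<in> space M. A \<subseteq> \<X> \<omega>} = Z * Determinant.det (submatrix ?K A A)"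
    if A: "A \<subseteq> {..<n}" for A
  proof -
    have "measure M {\<omega> \<in> space M. A \<subseteq> \<X> \<omega>}
        = c * (\<Sum>X | A \<subseteq> X \<and> X \<subseteq> {..<n}. ext_L_weight p L V X)"
      by (simp add: prob_superset_eq_sum[OF pp A] c sum_distrib_left)
    also have "\<dots> = c * ((- 1) ^ p
        * Determinant.det (bordered_mat (L + mat_diag n (\<lambda>i. if i \<in> A then 0 else 1)) (Q * R)))"
      by (simp add: sum_ext_L_weight_superset[OF L V A] flip: VR)
    finally show ?thesis
      by (simp add: det_bordered_eq_marginal[OF R A B(1,2)] kernel(1) Z_def mult_ac)
  qed
  \<comment> \<open>The empty set is always contained in the sample, and the empty minor is 1.\<close>
  have "Z = 1"
    using incl[of "{}"] prob_space by (simp add: submatrix_def)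
  have compl: "1\<^sub>m n - ?K = B - ?P"
    unfolding kernel(1)[symmetric] using B(1) Q by (auto simp: mat_eq_iff)
  have "DPP n M \<X> ?K"
    unfolding DPP_def compl
  proof (intro conjI allI impI)
    show "?K \<in> carrier_mat n n"
      using mult_carrier_mat[OF Lt B(1)] by (rule add_carrier_mat)
    show "measure M {\<omega> \<in> space M. A \<subseteq> \<X> \<omega>} = Determinant.det (submatrix ?K A A)"
      if "A \<subseteq> {..<n}" for A
      using incl[OF that] \<open>Z = 1\<close> by (simp only: mult_1)
  qed (fact pp kernel)+
  with \<open>invertible_mat ?N\<close> show ?thesis
    unfolding inv by (rule conjI)
qed

end
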